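(* Let $q\in(0,1)$ and let $\beta$ be a real number. For $x>0$ define $$g_{\beta}(q;x)=\frac{1}{1+q}\left[\frac{\Gamma_{q^2}\left(x+\frac{1}{2}\right)}{\Gamma_{q^2}(x+1)}\right]^{2}\exp\left[\frac{\beta(1-q^2)q^{2x}}{2(1-q^{2x})}+\psi_{q}(2x)\right].$$ If $\beta\geq \dfrac{-13\ln q}{6(1-q^2)}$, then the function $x\mapsto g_{\beta}(q;x)$ is logarithmically completely monotonic on $(0,\infty)$.
   Context: For $0<q<1$ and $x>0$ the $q$-gamma function is $$\Gamma_q(x)=(1-q)^{1-x}\prod_{j=0}^{\infty}\frac{1-q^{j+1}}{1-q^{j+x}},$$ and $\Gamma_{q^2}$ is the same function with $q$ replaced by $q^2$. The $q$-digamma function is $\psi_q(x)=\Gamma_q'(x)/\Gamma_q(x)$, the logarithmic derivative of $\Gamma_q$. A positive function $f$ is logarithmically completely monotonic on an interval $I$ if it has derivatives of all orders on $I$ and $(-1)^n\left(\ln f\right)^{(n)}(x)\geq 0$ for all $x\in I$ and all positive integers $n$. *)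

theory Defs
  imports "HOL-Analysis.Analysis"
begin

text \<open>
  The following functions are meant for \<open>0 < q < 1\<close> and \<open>x > 0\<close>. There no factor of the
  product vanishes and the product converges to a nonzero limit, so \<open>prodinf\<close> is its classical
  value.
\<close>

definition q_Gamma :: "real \<Rightarrow> real \<Rightarrow> real" where
  "q_Gamma q x = (1 - q) powr (1 - x) *
     (\<Prod>j. (1 - q ^ (j + 1)) / (1 - q powr (real j + x)))"

definition q_Digamma :: "real \<Rightarrow> real \<Rightarrow> real" where
  "q_Digamma q x = deriv (q_Gamma q) x / q_Gamma q x"

text \<open>
  Derivatives are two-sided, so this is the usual notion only when the interval \<open>I\<close> is open.
\<close>

definition log_completely_monotonic_on :: "(real \<Rightarrow> real) \<Rightarrow> real set \<Rightarrow> bool" where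
  "log_completely_monotonic_on f I \<longleftrightarrow>
     (\<forall>x\<in>I. f x > 0) \<and>
     (\<forall>n. \<forall>x\<in>I. (deriv ^^ n) f differentiable (at x)) \<and>
     (\<forall>n\<ge>1. \<forall>x\<in>I. (-1) ^ n * (deriv ^^ n) (\<lambda>y. ln (f y)) x \<ge> 0)"

definition g_fun :: "real \<Rightarrow> real \<Rightarrow> real \<Rightarrow> real" where
  "g_fun \<beta> q x =
     1 / (1 + q) * (q_Gamma (q\<^sup>2) (x + 1/2) / q_Gamma (q\<^sup>2) (x + 1))\<^sup>2 *
     exp (\<beta> * (1 - q\<^sup>2) * q powr (2 * x) / (2 * (1 - q powr (2 * x))) + q_Digamma q (2 * x))"

end

theory Submission
  imports Defs
begin

text \<open>
  For \<open>x > 0\<close> the logarithm of \<open>g\<close> is a power series in \<open>z = q\<^sup>2\<^sup>x\<close> without constant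
  term, and the bound on \<open>\<beta>\<close> makes all its coefficients nonnegative. Since \<open>z ^ m\<close> is
  \<open>exp (- 2 m x \<bar>ln q\<bar>)\<close>, whose \<open>n\<close>-th derivative has sign \<open>(-1) ^ n\<close>, termwise
  differentiation gives the theorem.

  The expansion rests on
  \<open>ln (\<Gamma>\<^sub>q x) = (1 - x) ln (1 - q) + \<Lambda> x - \<Lambda> 1\<close> with
  \<open>\<Lambda> x = (\<Sum>m\<ge>1. q ^ (m x) / (m (1 - q ^ m)))\<close>. The usual derivation expands the logarithm
  of each factor of the product and interchanges two summations. The interchange is avoided
  here: \<open>\<Lambda> x - \<Lambda> (x + 1) = - ln (1 - q ^ x)\<close>, so the sum of the logarithms
  telescopes, and \<open>\<Lambda>\<close> vanishes at infinity (\<open>sums_ln_q_factors\<close>, \<open>q_Gamma_eq_exp\<close>).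
  One more differentiation expands the q-digamma function, and the term with \<open>\<beta>\<close> is a
  geometric series. In the combination that defines \<open>g\<close> the logarithms of
  \<open>1 + q\<close>, \<open>1 - q\<close> and \<open>1 - q\<^sup>2\<close> cancel, and the coefficient of \<open>z ^ m\<close> is
  \<open>2 q ^ m / (m (1 + q ^ m)) + ln q / (1 - q ^ m) + \<beta> (1 - q\<^sup>2) / 2\<close>
  (\<open>g_fun_eq_exp\<close>).

  With \<open>t = - m ln q\<close> and \<open>\<beta>\<close> at its lower bound, nonnegativity of this coefficient
  is an inequality in the single variable \<open>t\<close>, which convexity settles
  (\<open>exp_inequality\<close>, \<open>coefficient_inequality\<close>).

  Logarithmic complete monotonicity also asks that \<open>g\<close> itself have derivatives of all orders.
  This holds because the products of \<open>g\<close> with power series in \<open>z\<close> are closed under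
  differentiation (\<open>higher_differentiable_exp_powr_series\<close>).
\<close>

section \<open>Power series on the unit disc, evaluated at an exponential\<close>

definition unit_disc_summable :: "(nat \<Rightarrow> real) \<Rightarrow> bool" where
  "unit_disc_summable a \<longleftrightarrow> (\<forall>z. \<bar>z\<bar> < 1 \<longrightarrow> summable (\<lambda>n. a n * z ^ n))"

definition powr_series :: "real \<Rightarrow> (nat \<Rightarrow> real) \<Rightarrow> real \<Rightarrow> real" where
  "powr_series r a x = (\<Sum>n. a n * (r powr x) ^ n)"

lemma abs_powr_less_1:
  fixes r x :: real
  assumes "0 < r" "r < 1" "0 < x"
  shows "\<bar>r powr x\<bar> < 1"
  using assms powr_less_mono2[of x r 1] by simp

lemma unit_disc_summableD: "unit_disc_summable a \<Longrightarrow> \<bar>z\<bar> < 1 \<Longrightarrow> summable (\<lambda>n. a n * z ^ n)"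
  by (simp add: unit_disc_summable_def)

lemma unit_disc_summable_bounded:
  assumes "\<And>n. \<bar>a n\<bar> \<le> B"
  shows "unit_disc_summable a"
  unfolding unit_disc_summable_def
proof (intro allI impI)
  fix z :: real
  assume z: "\<bar>z\<bar> < 1"
  have "summable (\<lambda>n. B * \<bar>z\<bar> ^ n)"
    using z by (intro summable_mult summable_geometric) simp
  moreover have "norm (a n * z ^ n) \<le> B * \<bar>z\<bar> ^ n" for n
    using assms[of n] by (simp add: abs_mult power_abs mult_right_mono)
  ultimately show "summable (\<lambda>n. a n * z ^ n)"
    by (rule summable_comparison_test')
qed

lemma unit_disc_abs_summable:
  assumes "unit_disc_summable a" "\<bar>z\<bar> < 1"
  shows "summable (\<lambda>n. norm (a n * z ^ n))"
proof (rule powser_insidea)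
  show "summable (\<lambda>n. a n * ((1 + \<bar>z\<bar>) / 2) ^ n)"
    using assms by (intro unit_disc_summableD) auto
  show "norm z < norm ((1 + \<bar>z\<bar>) / 2)"
    using assms by simp
qed

lemma unit_disc_summable_add:
  "unit_disc_summable a \<Longrightarrow> unit_disc_summable b \<Longrightarrow> unit_disc_summable (\<lambda>n. a n + b n)"
  by (auto simp: unit_disc_summable_def distrib_right intro: summable_add)

text \<open>
  The operator \<open>z d/dz\<close> multiplies the coefficient of \<open>z ^ n\<close> by \<open>n\<close>. Unlike \<open>d/dz\<close> it does
  not shift indices, and it is what differentiation in \<open>x\<close> becomes, up to the factor
  \<open>ln r\<close>, under \<open>z = r powr x\<close>.
\<close>
lemma euler_sums:
  fixes z :: real
  assumes "unit_disc_summable a" "\<bar>z\<bar> < 1"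
  shows "(\<lambda>n. real n * a n * z ^ n) sums (z * (\<Sum>n. diffs a n * z ^ n))"
proof -
  have "summable (\<lambda>n. diffs a n * z ^ n)"
    using assms by (intro termdiff_converges[of z 1 a]) (auto simp: unit_disc_summable_def)
  from sums_mult[OF diffs_equiv[OF this], of z]
  show ?thesis
  proof (rule sums_cong[THEN iffD1, rotated])
    show "z * (of_nat n * a n * z ^ (n - Suc 0)) = real n * a n * z ^ n" for n
      by (cases n) auto
  qed
qed

lemma unit_disc_summable_euler:
  assumes "unit_disc_summable a"
  shows "unit_disc_summable (\<lambda>n. real n * c * a n)"
  unfolding unit_disc_summable_def
proof (intro allI impI)
  fix z :: real
  assume "\<bar>z\<bar> < 1"
  from summable_mult[OF sums_summable[OF euler_sums[OF assms this]], of c]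
  show "summable (\<lambda>n. real n * c * a n * z ^ n)"
    by (simp add: mult_ac)
qed

lemma unit_disc_summable_euler_power:
  assumes "unit_disc_summable a"
  shows "unit_disc_summable (\<lambda>m. (real m * c) ^ k * a m)"
proof (induction k)
  case (Suc k)
  from unit_disc_summable_euler[OF this, of c] show ?case by (simp add: mult_ac)
qed (use assms in simp)

lemma powr_series_deriv:
  assumes r: "0 < r" "r < 1" and a: "unit_disc_summable a" and x: "0 < x"
  shows "(powr_series r a has_real_derivative powr_series r (\<lambda>n. real n * ln r * a n) x) (at x)"
proof -
  define z where "z = r powr x"
  have z: "\<bar>z\<bar> < 1"
    using abs_powr_less_1[OF r x] by (simp add: z_def)
  have "((\<lambda>w. \<Sum>n. a n * w ^ n) has_real_derivative (\<Sum>n. diffs a n * z ^ n)) (at z)"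
    using a z by (intro termdiffs_strong'[of 1]) (auto simp: unit_disc_summable_def)
  moreover have "((\<lambda>x. r powr x) has_real_derivative z * ln r) (at x)"
    unfolding z_def using r by (auto intro!: derivative_eq_intros)
  ultimately have "((\<lambda>x. \<Sum>n. a n * (r powr x) ^ n) has_real_derivative
      (\<Sum>n. diffs a n * z ^ n) * (z * ln r)) (at x)"
    unfolding z_def by (rule DERIV_chain2)
  moreover have "(\<lambda>n. real n * ln r * a n * z ^ n) sums ((\<Sum>n. diffs a n * z ^ n) * (z * ln r))"
    using sums_mult[OF euler_sums[OF a z], of "ln r"] by (simp add: mult_ac)
  ultimately show ?thesis
    unfolding powr_series_def[abs_def] z_def by (simp add: sums_iff)
qed

lemma powr_series_mult:
  assumes r: "0 < r" "r < 1" and x: "0 < x"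
    and a: "unit_disc_summable a" and b: "unit_disc_summable b"
  shows "powr_series r a x * powr_series r b x = powr_series r (\<lambda>n. \<Sum>i\<le>n. a i * b (n - i)) x"
proof -
  note z = abs_powr_less_1[OF r x]
  have "powr_series r a x * powr_series r b x =
      (\<Sum>n. \<Sum>i\<le>n. (a i * (r powr x) ^ i) * (b (n - i) * (r powr x) ^ (n - i)))"
    unfolding powr_series_def by (intro Cauchy_product unit_disc_abs_summable a b z)
  also have "\<dots> = powr_series r (\<lambda>n. \<Sum>i\<le>n. a i * b (n - i)) x"
    unfolding powr_series_def sum_distrib_right
    by (intro suminf_cong sum.cong refl)
       (simp add: mult_ac flip: power_add)
  finally show ?thesis .
qed

lemma unit_disc_summable_Cauchy:
  assumes a: "unit_disc_summable a" and b: "unit_disc_summable b"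
  shows "unit_disc_summable (\<lambda>n. \<Sum>i\<le>n. a i * b (n - i))"
  unfolding unit_disc_summable_def
proof (intro allI impI)
  fix z :: real
  assume z: "\<bar>z\<bar> < 1"
  have "summable (\<lambda>n. \<Sum>i\<le>n. (a i * z ^ i) * (b (n - i) * z ^ (n - i)))"
    by (intro summable_Cauchy_product unit_disc_abs_summable a b z)
  also have "(\<lambda>n. \<Sum>i\<le>n. (a i * z ^ i) * (b (n - i) * z ^ (n - i))) =
      (\<lambda>n. (\<Sum>i\<le>n. a i * b (n - i)) * z ^ n)"
    unfolding sum_distrib_right
    by (intro ext sum.cong refl) (simp add: mult_ac flip: power_add)
  finally show "summable (\<lambda>n. (\<Sum>i\<le>n. a i * b (n - i)) * z ^ n)" .
qed

lemma powr_series_add: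
  assumes r: "0 < r" "r < 1" and x: "0 < x"
    and a: "unit_disc_summable a" and b: "unit_disc_summable b"
  shows "powr_series r a x + powr_series r b x = powr_series r (\<lambda>n. a n + b n) x"
  unfolding powr_series_def distrib_right
  by (intro suminf_add unit_disc_summableD a b abs_powr_less_1 r x)

section \<open>Higher derivatives\<close>

text \<open>
  The iterated \<open>deriv\<close> of \<open>f\<close> is controlled although \<open>f\<close> is known only on \<open>S\<close>: as \<open>S\<close>
  is open, each derivative at a point of \<open>S\<close> depends only on values on \<open>S\<close>.
\<close>
lemma higher_deriv_chain:
  fixes D :: "nat \<Rightarrow> real \<Rightarrow> real"
  assumes S: "open S"
    and f: "\<And>x. x \<in> S \<Longrightarrow> f x = D 0 x"
    and D: "\<And>n x. x \<in> S \<Longrightarrow> (D n has_real_derivative D (Suc n) x) (at x)"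
    and x: "x \<in> S"
  shows "(deriv ^^ n) f x = D n x" and "((deriv ^^ n) f has_real_derivative D (Suc n) x) (at x)"
proof -
  have step: "(h has_real_derivative D (Suc n) y) (at y)"
    if "\<And>y. y \<in> S \<Longrightarrow> h y = D n y" "y \<in> S" for h n y
    using D[OF that(2)] S that(2) by (rule has_field_derivative_transform_within_open) (simp add: that(1))
  have eq: "\<forall>x\<in>S. (deriv ^^ n) f x = D n x" for n
  proof (induction n)
    case (Suc n)
    then show ?case
      using step[of "(deriv ^^ n) f" n] by (auto intro: DERIV_imp_deriv)
  qed (use f in auto)
  then show "(deriv ^^ n) f x = D n x" using x by blast
  show "((deriv ^^ n) f has_real_derivative D (Suc n) x) (at x)"
    using step eq x by blast
qed

lemma higher_deriv_powr_series:
  assumes r: "0 < r" "r < 1" and a: "unit_disc_summable a"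
    and f: "\<And>x. 0 < x \<Longrightarrow> f x = powr_series r a x" and x: "0 < x"
  shows "(deriv ^^ n) f x = powr_series r (\<lambda>m. (real m * ln r) ^ n * a m) x"
proof -
  note summ = unit_disc_summable_euler_power[OF a, of "ln r"]
  have "(powr_series r (\<lambda>m. (real m * ln r) ^ k * a m) has_real_derivative
      powr_series r (\<lambda>m. (real m * ln r) ^ Suc k * a m) y) (at y)" if "y \<in> {0<..}" for k y
    using powr_series_deriv[OF r summ[of k], of y] that by (simp add: mult_ac)
  then show ?thesis
    using f x by (intro higher_deriv_chain(1)[where S = "{0<..}"
          and D = "\<lambda>k. powr_series r (\<lambda>m. (real m * ln r) ^ k * a m)"]) auto
qed

text \<open>
  Write \<open>A\<close> for the series in the exponent. Every derivative has the form \<open>exp A * B\<close> with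
  another series \<open>B\<close>, because \<open>(exp A * B)' = exp A * (A' * B + B')\<close> and the Cauchy product
  makes \<open>A' * B + B'\<close> a series again. The proof iterates this step on coefficients.
\<close>
lemma higher_differentiable_exp_powr_series:
  assumes r: "0 < r" "r < 1" and a: "unit_disc_summable a"
    and f: "\<And>x. 0 < x \<Longrightarrow> f x = exp (powr_series r a x)" and x: "0 < x"
  shows "(deriv ^^ n) f differentiable (at x)"
proof -
  define a' where "a' = (\<lambda>m. real m * ln r * a m)"
  define next_coeff where
    "next_coeff b = (\<lambda>n. (\<Sum>i\<le>n. a' i * b (n - i)) + real n * ln r * b n)" for b
  define b where "b k = (next_coeff ^^ k) (\<lambda>n. if n = 0 then 1 else 0)" for k
  have a': "unit_disc_summable a'"
    unfolding a'_def by (rule unit_disc_summable_euler[OF a])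
  have b: "unit_disc_summable (b k)" for k
  proof (induction k)
    case 0
    show ?case by (rule unit_disc_summable_bounded[of _ 1]) (simp add: b_def)
  next
    case (Suc k)
    then have "unit_disc_summable (next_coeff (b k))"
      unfolding next_coeff_def
      by (intro unit_disc_summable_add unit_disc_summable_Cauchy unit_disc_summable_euler a')
    then show ?case by (simp add: b_def)
  qed
  define D where "D k y = exp (powr_series r a y) * powr_series r (b k) y" for k y
  have D: "(D k has_real_derivative D (Suc k) y) (at y)" if y: "y \<in> {0<..}" for k y
  proof -
    have y': "0 < y" using y by simp
    have "(D k has_real_derivative
        exp (powr_series r a y) * powr_series r a' y * powr_series r (b k) y
        + powr_series r (\<lambda>n. real n * ln r * b k n) y * exp (powr_series r a y)) (at y)"
      unfolding D_def a'_def
      by (intro DERIV_mult DERIV_fun_exp powr_series_deriv r a b y')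
    also have "exp (powr_series r a y) * powr_series r a' y * powr_series r (b k) y
        + powr_series r (\<lambda>n. real n * ln r * b k n) y * exp (powr_series r a y)
      = exp (powr_series r a y) * (powr_series r a' y * powr_series r (b k) y
        + powr_series r (\<lambda>n. real n * ln r * b k n) y)"
      by (simp add: algebra_simps)
    also have "powr_series r a' y * powr_series r (b k) y
        + powr_series r (\<lambda>n. real n * ln r * b k n) y = powr_series r (next_coeff (b k)) y"
      unfolding next_coeff_def powr_series_mult[OF r y' a' b]
      by (intro powr_series_add r y' unit_disc_summable_Cauchy unit_disc_summable_euler a' b)
    finally show ?thesis by (simp add: D_def[abs_def] b_def)
  qed
  have "powr_series r (b 0) y = 1" for y
  proof -
    have "powr_series r (b 0) y = (\<Sum>n. if n = 0 then 1 else 0)"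
      unfolding powr_series_def b_def by (intro suminf_cong) simp
    then show ?thesis using sums_unique[OF sums_single[of 0 "\<lambda>_. 1::real"]] by simp
  qed
  then have "((deriv ^^ n) f has_real_derivative D (Suc n) x) (at x)"
    using f x by (intro higher_deriv_chain(2)[where S = "{0<..}"] D) (auto simp: D_def)
  then show ?thesis
    unfolding real_differentiable_def by blast
qed

text \<open>
  Each differentiation multiplies the \<open>m\<close>-th coefficient by \<open>m * ln r \<le> 0\<close>, so the signs
  alternate. The constant term disappears after one step, so its sign is free.
\<close>
lemma log_completely_monotonic_on_exp_powr_series:
  assumes r: "0 < r" "r < 1" and a: "unit_disc_summable a"
    and nonneg: "\<And>m. 1 \<le> m \<Longrightarrow> 0 \<le> a m"
    and f: "\<And>x. 0 < x \<Longrightarrow> f x = exp (powr_series r a x)"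
  shows "log_completely_monotonic_on f {0<..}"
  unfolding log_completely_monotonic_on_def
proof (intro conjI ballI allI impI)
  show "0 < f x" if "x \<in> {0<..}" for x using f that by simp
  show "(deriv ^^ n) f differentiable (at x)" if "x \<in> {0<..}" for n x
    using higher_differentiable_exp_powr_series[OF r a f] that by simp
  fix n :: nat and x :: real
  assume n: "1 \<le> n" and "x \<in> {0<..}"
  then have x: "0 < x" by simp
  define c where "c m = (real m * ln r) ^ n * a m" for m
  have "(-1) ^ n * c m = (real m * (- ln r)) ^ n * a m" for m
    unfolding c_def by (metis (no_types) mult.assoc mult_minus_right power_minus)
  moreover have "0 \<le> (real m * (- ln r)) ^ n * a m" for m
  proof (cases "m = 0")
    case True
    then show ?thesis using n by (simp add: power_0_left)
  next
    case False
    have "ln r \<le> 0" using r by simp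
    then show ?thesis
      using False nonneg[of m] by (intro mult_nonneg_nonneg zero_le_power) auto
  qed
  ultimately have sgn: "0 \<le> (-1) ^ n * c m" for m by simp
  have cs: "unit_disc_summable c"
    unfolding c_def by (rule unit_disc_summable_euler_power[OF a])
  have "(deriv ^^ n) (\<lambda>y. ln (f y)) x = powr_series r c x"
    unfolding c_def using f x by (intro higher_deriv_powr_series r a) auto
  then have "(-1) ^ n * (deriv ^^ n) (\<lambda>y. ln (f y)) x = (\<Sum>m. (-1) ^ n * c m * (r powr x) ^ m)"
    unfolding powr_series_def
    using suminf_mult[OF unit_disc_summableD[OF cs abs_powr_less_1[OF r x]], of "(-1)^n"]
    by (simp add: mult.assoc)
  also have "\<dots> \<ge> 0"
  proof (rule suminf_nonneg)
    show "summable (\<lambda>m. (-1) ^ n * c m * (r powr x) ^ m)"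
      using summable_mult[OF unit_disc_summableD[OF cs abs_powr_less_1[OF r x]], of "(-1)^n"]
      by (simp add: mult.assoc)
    show "0 \<le> (-1) ^ n * c m * (r powr x) ^ m" for m
      by (rule mult_nonneg_nonneg[OF sgn]) simp
  qed
  finally show "0 \<le> (-1) ^ n * (deriv ^^ n) (\<lambda>y. ln (f y)) x" .
qed

section \<open>The q-gamma function as an exponential\<close>

text \<open>
  The coefficients of \<open>\<Lambda>\<close>. Division by zero makes the coefficient at \<open>m = 0\<close> equal to \<open>0\<close>,
  so there is no constant term.
\<close>
definition ln_qGamma_coeff :: "real \<Rightarrow> nat \<Rightarrow> real" where
  "ln_qGamma_coeff q m = 1 / (real m * (1 - q ^ m))"

lemma unit_disc_summable_inverse_one_minus_power:
  assumes q: "0 < q" "q < (1::real)" and b: "\<And>m. \<bar>b m\<bar> \<le> B"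
  shows "unit_disc_summable (\<lambda>m. b m / (1 - q ^ m))"
proof (rule unit_disc_summable_bounded)
  fix m
  have B: "0 \<le> B" using b[of 0] by simp
  show "\<bar>b m / (1 - q ^ m)\<bar> \<le> B / (1 - q)"
  proof (cases "m = 0")
    case True
    then show ?thesis using B q by simp
  next
    case False
    then have "q ^ m \<le> q" using q power_decreasing[of 1 m q] by simp
    moreover from this have "0 < 1 - q ^ m" using q by linarith
    ultimately show ?thesis
      using q b[of m] by (auto simp: abs_divide intro!: frac_le)
  qed
qed

lemma unit_disc_summable_ln_qGamma:
  assumes q: "0 < q" "q < 1"
  shows "unit_disc_summable (ln_qGamma_coeff q)"
proof -
  have "\<bar>1 / real m\<bar> \<le> 1" for m by (cases "m = 0") auto
  from unit_disc_summable_inverse_one_minus_power[OF q this]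
  show ?thesis unfolding ln_qGamma_coeff_def[abs_def] by (simp add: divide_divide_eq_left)
qed

text \<open>
  Shifting \<open>x\<close> by one multiplies the \<open>m\<close>-th term by \<open>q ^ m\<close>, which cancels the
  denominator \<open>1 - q ^ m\<close> in the difference and leaves the logarithm series.
\<close>
lemma powr_series_ln_qGamma_diff:
  assumes q: "0 < q" "q < 1" and x: "0 < x"
  shows "powr_series q (ln_qGamma_coeff q) x - powr_series q (ln_qGamma_coeff q) (x + 1)
      = - ln (1 - q powr x)"
proof -
  have z: "\<bar>q powr x\<bar> < 1" by (rule abs_powr_less_1[OF q x])
  have x1: "0 < x + 1" using x by simp
  note summ = unit_disc_summableD[OF unit_disc_summable_ln_qGamma[OF q]]
  have "powr_series q (ln_qGamma_coeff q) x - powr_series q (ln_qGamma_coeff q) (x + 1) =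
     (\<Sum>m. ln_qGamma_coeff q m * (q powr x) ^ m - ln_qGamma_coeff q m * (q powr (x + 1)) ^ m)"
    unfolding powr_series_def
    by (intro suminf_diff summ z abs_powr_less_1[OF q x1])
  also have "\<dots> = (\<Sum>m. (q powr x) ^ m / real m)"
  proof (intro suminf_cong)
    fix m
    show "ln_qGamma_coeff q m * (q powr x) ^ m - ln_qGamma_coeff q m * (q powr (x + 1)) ^ m
        = (q powr x) ^ m / real m"
    proof (cases "m = 0")
      case True
      then show ?thesis by (simp add: ln_qGamma_coeff_def)
    next
      case False
      then have "q ^ m < 1" using q by (simp add: power_less_one_iff)
      then have "q ^ m \<noteq> 1" by simp
      moreover have "(q powr (x + 1)) ^ m = (q powr x) ^ m * q ^ m"
        using q by (simp add: powr_add power_mult_distrib)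
      ultimately show ?thesis
        using False by (simp add: ln_qGamma_coeff_def divide_simps) (simp add: algebra_simps)
    qed
  qed
  also have "\<dots> = - ln (1 - q powr x)"
  proof -
    have "\<bar>- (q powr x)\<bar> < 1" using z by simp
    from sums_minus[OF ln_series'[OF this]]
    have "(\<lambda>m. (q powr x) ^ m / real m) sums (- ln (1 - q powr x))" by simp
    then show ?thesis by (simp add: sums_iff)
  qed
  finally show ?thesis .
qed

text \<open>
  By the difference equation the partial sums telescope to \<open>\<Lambda> x - \<Lambda> (x + N)\<close>. The
  remainder tends to \<open>0\<close> because \<open>q powr (x + N)\<close> does and the power series has no constant term.
\<close>
lemma sums_ln_q_factors:
  assumes q: "0 < q" "q < 1" and x: "0 < x"
  shows "(\<lambda>j. - ln (1 - q powr (real j + x))) sums powr_series q (ln_qGamma_coeff q) x"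
proof -
  let ?L = "powr_series q (ln_qGamma_coeff q)"
  have partial: "(\<Sum>j<N. - ln (1 - q powr (real j + x))) = ?L x - ?L (real N + x)" for N
  proof (induction N)
    case (Suc N)
    with powr_series_ln_qGamma_diff[OF q, of "real N + x"] x show ?case
      by (simp add: add_ac)
  qed simp
  have "(\<lambda>N. ?L (real N + x)) \<longlonglongrightarrow> (\<Sum>m. ln_qGamma_coeff q m * 0 ^ m)"
    unfolding powr_series_def
  proof (rule isCont_tendsto_compose[where g = "\<lambda>z. \<Sum>m. ln_qGamma_coeff q m * z ^ m"])
    show "isCont (\<lambda>z. \<Sum>m. ln_qGamma_coeff q m * z ^ m) 0"
      using unit_disc_summableD[OF unit_disc_summable_ln_qGamma[OF q], of "1/2"]
      by (intro isCont_powser[where K = "1/2"]) auto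
    have "(\<lambda>N. q powr x * q ^ N) \<longlonglongrightarrow> q powr x * 0"
      using q by (intro tendsto_mult tendsto_const LIMSEQ_realpow_zero) auto
    moreover have "q powr (real N + x) = q powr x * q ^ N" for N
      using q by (simp add: powr_add powr_realpow)
    ultimately show "(\<lambda>N. q powr (real N + x)) \<longlonglongrightarrow> 0" by simp
  qed
  also have "(\<lambda>m. ln_qGamma_coeff q m * 0 ^ m) = (\<lambda>m. 0)"
    by (auto simp: ln_qGamma_coeff_def power_0_left)
  finally have "(\<lambda>N. ?L x - ?L (real N + x)) \<longlonglongrightarrow> ?L x - 0"
    by (intro tendsto_diff tendsto_const) simp
  then show ?thesis
    unfolding sums_def partial by simp
qed

lemma q_Gamma_eq_exp:
  assumes q: "0 < q" "q < 1" and x: "0 < x"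
  shows "q_Gamma q x = exp ((1 - x) * ln (1 - q) + powr_series q (ln_qGamma_coeff q) x
      - powr_series q (ln_qGamma_coeff q) 1)"
proof -
  let ?L = "powr_series q (ln_qGamma_coeff q)"
  define F where "F j = - ln (1 - q powr (real j + x)) - - ln (1 - q powr (real j + 1))" for j
  have F: "F sums (?L x - ?L 1)"
    unfolding F_def by (intro sums_diff sums_ln_q_factors q x) simp
  \<comment> \<open>The numerators \<open>1 - q ^ (j + 1)\<close> are the denominators at \<open>x = 1\<close>.\<close>
  have "(1 - q ^ (j + 1)) / (1 - q powr (real j + x)) = exp (F j)" for j
  proof -
    have "q powr (real j + x) < 1" "q powr (real j + 1) < 1"
      using abs_powr_less_1[OF q, of "real j + x"] abs_powr_less_1[OF q, of "real j + 1"] x by auto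
    moreover have "q ^ (j + 1) = q powr (real j + 1)"
      using powr_realpow[OF q(1), of "j + 1"] by (simp add: add_ac)
    ultimately show ?thesis
      by (simp add: F_def exp_diff exp_minus divide_inverse exp_add mult.commute)
  qed
  then have "(\<Prod>j. (1 - q ^ (j + 1)) / (1 - q powr (real j + x))) = exp (?L x - ?L 1)"
    using prodinf_exp[of F] F by (simp add: sums_iff)
  then show ?thesis
    using q by (simp add: q_Gamma_def powr_def exp_add[symmetric] exp_diff[symmetric] add_diff_eq)
qed

lemma q_Digamma_eq:
  assumes q: "0 < q" "q < 1" and x: "0 < x"
  shows "q_Digamma q x = - ln (1 - q) + powr_series q (\<lambda>m. real m * ln q * ln_qGamma_coeff q m) x"
proof -
  let ?L = "powr_series q (ln_qGamma_coeff q)"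
  let ?E = "\<lambda>x. exp ((1 - x) * ln (1 - q) + ?L x - ?L 1)"
  have "(?E has_real_derivative
      ?E x * (- ln (1 - q) + powr_series q (\<lambda>m. real m * ln q * ln_qGamma_coeff q m) x)) (at x)"
    by (auto intro!: derivative_eq_intros powr_series_deriv[OF q unit_disc_summable_ln_qGamma[OF q] x])
  then have "(q_Gamma q has_real_derivative
      ?E x * (- ln (1 - q) + powr_series q (\<lambda>m. real m * ln q * ln_qGamma_coeff q m) x)) (at x)"
    by (rule has_field_derivative_transform_within_open[where S = "{0<..}"])
       (use q_Gamma_eq_exp[OF q] x in auto)
  from DERIV_imp_deriv[OF this] show ?thesis
    by (simp add: q_Digamma_def q_Gamma_eq_exp[OF q x])
qed

section \<open>The coefficient inequality\<close>

text \<open>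
  The right-hand side and its first derivative vanish at \<open>0\<close>, and its second derivative
  \<open>4 * exp t * (exp t + t * exp t - 3 * t)\<close> is nonnegative by \<open>exp t \<ge> 1 + t\<close>.
\<close>
lemma exp_inequality:
  fixes t :: real
  assumes "0 \<le> t"
  shows "0 \<le> 24 * exp t - 24 - 12 * t * exp t - 13 * t + t * (exp t)\<^sup>2"
proof -
  define h where "h t = 24 * exp t - 24 - 12 * t * exp t - 13 * t + t * (exp t)\<^sup>2" for t :: real
  define h' where "h' t = 12 * exp t - 12 * t * exp t - 13 + (exp t)\<^sup>2 + 2 * t * (exp t)\<^sup>2" for t :: real
  define h'' where "h'' t = 4 * exp t * (exp t + t * exp t - 3 * t)" for t :: real
  have h: "(h has_real_derivative h' s) (at s)" for s
    unfolding h_def h'_def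
    by (auto intro!: derivative_eq_intros simp: algebra_simps power2_eq_square)
  have h': "(h' has_real_derivative h'' s) (at s)" for s
    unfolding h'_def h''_def
    by (auto intro!: derivative_eq_intros simp: algebra_simps power2_eq_square)
  have h''_nonneg: "0 \<le> h'' s" if "0 \<le> s" for s
  proof -
    have "(1 + s) * (1 + s) \<le> exp s * (1 + s)"
      using that by (intro mult_right_mono) auto
    moreover have "0 \<le> (1 + s) * (1 + s) - 3 * s"
      using that sum_power2_ge_zero[of "s - 1/2" 0] by (simp add: power2_eq_square algebra_simps)
    ultimately have "0 \<le> exp s + s * exp s - 3 * s"
      by (simp add: algebra_simps)
    then show ?thesis by (simp add: h''_def)
  qed
  have h'_nonneg: "0 \<le> h' s" if "0 \<le> s" for s
  proof -
    have "h' 0 \<le> h' s"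
      using that h' h''_nonneg by (intro DERIV_nonneg_imp_nondecreasing[of 0 s h']) blast+
    then show ?thesis by (simp add: h'_def)
  qed
  have "h 0 \<le> h t"
    using assms h h'_nonneg by (intro DERIV_nonneg_imp_nondecreasing[of 0 t h]) blast+
  then show ?thesis by (simp add: h_def)
qed

text \<open>
  After multiplication by \<open>12 * (exp (2 * t) - 1)\<close> this is \<open>exp_inequality\<close>.
\<close>
lemma coefficient_inequality:
  fixes t :: real
  assumes "0 < t"
  shows "0 \<le> 2 * exp (- t) / (1 + exp (- t)) - t / (1 - exp (- t)) + 13 * t / 12"
proof -
  define E where "E = exp t"
  have E: "1 < E" using assms by (simp add: E_def)
  have "0 \<le> (24 * E - 24 - 12 * t * E - 13 * t + t * E\<^sup>2) / (12 * (E\<^sup>2 - 1))"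
    using exp_inequality[of t] assms E by (intro divide_nonneg_pos) (auto simp: E_def one_less_power)
  also have "\<dots> = 2 / (E + 1) - t * E / (E - 1) + 13 * t / 12"
  proof -
    have "E\<^sup>2 - 1 = (E - 1) * (E + 1)" by (simp add: power2_eq_square algebra_simps)
    moreover have "E - 1 \<noteq> 0" "E + 1 \<noteq> 0" using E by auto
    ultimately show ?thesis by (simp add: divide_simps) (simp add: algebra_simps power2_eq_square)
  qed
  also have "2 / (E + 1) = 2 * exp (- t) / (1 + exp (- t))"
    using E by (simp add: exp_minus E_def[symmetric] divide_simps)
  also have "t * E / (E - 1) = t / (1 - exp (- t))"
    using E by (simp add: exp_minus E_def[symmetric] divide_simps)
  finally show ?thesis .
qed

section \<open>The expansion of the logarithm of g\<close>

definition ln_g_coeff :: "real \<Rightarrow> real \<Rightarrow> nat \<Rightarrow> real" where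
  "ln_g_coeff \<beta> q m = (if m = 0 then 0 else
     2 * q ^ m / (real m * (1 + q ^ m)) + ln q / (1 - q ^ m) + \<beta> * (1 - q\<^sup>2) / 2)"

text \<open>
  At \<open>t = - m * ln q\<close> the inequality above is \<open>m\<close> times the nonnegativity of the
  coefficient for the least admissible \<open>\<beta>\<close>, and the coefficient increases with \<open>\<beta>\<close>.
\<close>
lemma ln_g_coeff_nonneg:
  assumes q: "0 < q" "q < 1" and \<beta>: "- 13 * ln q / (6 * (1 - q\<^sup>2)) \<le> \<beta>"
  shows "0 \<le> ln_g_coeff \<beta> q m"
proof (cases "m = 0")
  case False
  define t where "t = - real m * ln q"
  have t: "0 < t" using q False by (simp add: t_def mult_pos_neg)
  have qm: "q ^ m = exp (- t)"
    using q by (simp add: t_def exp_of_nat_mult)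
  have "0 < 6 * (1 - q\<^sup>2)" using q by (simp add: power_less_one_iff)
  from \<beta>[unfolded pos_divide_le_eq[OF this]] have "- 13 * ln q / 12 \<le> \<beta> * (1 - q\<^sup>2) / 2"
    by (simp add: algebra_simps)
  moreover have "0 \<le> (2 * exp (- t) / (1 + exp (- t)) - t / (1 - exp (- t)) + 13 * t / 12) / real m"
    using coefficient_inequality[OF t] by simp
  then have "0 \<le> 2 * q ^ m / (real m * (1 + q ^ m)) + ln q / (1 - q ^ m) - 13 * ln q / 12"
    using False unfolding qm[symmetric]
    by (simp add: add_divide_distrib diff_divide_distrib t_def mult.commute)
  ultimately have "0 \<le> 2 * q ^ m / (real m * (1 + q ^ m)) + ln q / (1 - q ^ m)
      + \<beta> * (1 - q\<^sup>2) / 2"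
    by linarith
  then show ?thesis using False by (simp add: ln_g_coeff_def)
qed (simp add: ln_g_coeff_def)

lemma unit_disc_summable_ln_g:
  assumes q: "0 < q" "q < 1"
  shows "unit_disc_summable (ln_g_coeff \<beta> q)"
proof -
  define c where "c m = (if m = 0 then 0 else
      2 * q ^ m / (real m * (1 + q ^ m)) + \<beta> * (1 - q\<^sup>2) / 2)" for m :: nat
  have "unit_disc_summable (\<lambda>m. ln q / (1 - q ^ m))"
    by (rule unit_disc_summable_inverse_one_minus_power[OF q]) (rule order_refl)
  moreover have "unit_disc_summable c"
  proof (rule unit_disc_summable_bounded)
    fix m
    have "\<bar>2 * q ^ m / (real m * (1 + q ^ m))\<bar> \<le> 2 / 1" if "m \<noteq> 0"
    proof -
      have "1 * 1 \<le> real m * (1 + q ^ m)" using that q by (intro mult_mono) auto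
      moreover have "q ^ m \<le> 1" using q by (simp add: power_le_one)
      ultimately have "2 * q ^ m / (real m * (1 + q ^ m)) \<le> 2 / 1"
        using q by (intro frac_le) auto
      then show ?thesis using q by simp
    qed
    then show "\<bar>c m\<bar> \<le> 2 + \<bar>\<beta> * (1 - q\<^sup>2) / 2\<bar>"
      unfolding c_def using abs_triangle_ineq[of "2 * q ^ m / (real m * (1 + q ^ m))" "\<beta> * (1 - q\<^sup>2) / 2"]
      by (cases "m = 0") auto
  qed
  ultimately have "unit_disc_summable (\<lambda>m. ln q / (1 - q ^ m) + c m)"
    by (rule unit_disc_summable_add)
  moreover have "(\<lambda>m. ln q / (1 - q ^ m) + c m) = ln_g_coeff \<beta> q"
    by (auto simp: c_def ln_g_coeff_def)
  ultimately show ?thesis by simp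
qed

text \<open>
  With \<open>z = q powr (2 * x)\<close>, the shifts by \<open>1/2\<close> and \<open>1\<close> turn into the factors \<open>q ^ m\<close> and
  \<open>q ^ (2 * m)\<close> of the \<open>m\<close>-th term, so the gamma quotient contributes
  \<open>2 * (q ^ m - q ^ (2 * m)) / (m * (1 - q ^ (2 * m))) = 2 * q ^ m / (m * (1 + q ^ m))\<close>.
\<close>
lemma ln_g_expansion:
  assumes q: "0 < q" "q < 1" and x: "0 < x"
  defines "L \<equiv> powr_series (q\<^sup>2) (ln_qGamma_coeff (q\<^sup>2))"
  defines "P \<equiv> powr_series q (\<lambda>m. real m * ln q * ln_qGamma_coeff q m)"
  shows "2 * (L (x + 1/2) - L (x + 1)) + P (2 * x)
      + \<beta> * (1 - q\<^sup>2) * q powr (2 * x) / (2 * (1 - q powr (2 * x)))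
      = powr_series (q\<^sup>2) (ln_g_coeff \<beta> q) x"
proof -
  define z where "z = q powr (2 * x)"
  have z: "\<bar>z\<bar> < 1" unfolding z_def using x by (intro abs_powr_less_1 q) simp
  have p: "0 < q\<^sup>2" "q\<^sup>2 < 1" using q by (auto simp: power_less_one_iff)
  have q2: "q\<^sup>2 powr y = q powr (2 * y)" for y
    using q powr_powr[of q 2 y] by simp
  have zx: "q\<^sup>2 powr x = z" "q\<^sup>2 powr (x + 1/2) = z * q" "q\<^sup>2 powr (x + 1) = z * q\<^sup>2"
    unfolding q2 z_def using q by (simp_all add: distrib_left powr_add)
  have sL: "(\<lambda>m. ln_qGamma_coeff (q\<^sup>2) m * (q\<^sup>2 powr y) ^ m) sums L y" if "0 < y" for y
    unfolding L_def powr_series_def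
    by (intro summable_sums unit_disc_summableD unit_disc_summable_ln_qGamma p
        abs_powr_less_1 that)
  have sP: "(\<lambda>m. real m * ln q * ln_qGamma_coeff q m * z ^ m) sums P (2 * x)"
    unfolding P_def powr_series_def z_def[symmetric]
    by (intro summable_sums unit_disc_summableD unit_disc_summable_euler
        unit_disc_summable_ln_qGamma q z)
  have sG: "(\<lambda>m. (if m = 0 then 0 else 1) * z ^ m) sums (z / (1 - z))"
  proof -
    have "(\<lambda>m. z ^ m - (if m = 0 then 1 else 0)) sums (1 / (1 - z) - 1)"
      using z sums_single[of 0 "\<lambda>_. 1::real"] by (intro sums_diff geometric_sums) auto
    moreover have "1 / (1 - z) - 1 = z / (1 - z)" using z by (simp add: field_simps)
    moreover have "(\<lambda>m. z ^ m - (if m = 0 then 1 else 0)) = (\<lambda>m. (if m = 0 then 0 else 1) * z ^ m)"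
      by auto
    ultimately show ?thesis by simp
  qed
  have "(\<lambda>m. 2 * (ln_qGamma_coeff (q\<^sup>2) m * (q\<^sup>2 powr (x + 1/2)) ^ m
        - ln_qGamma_coeff (q\<^sup>2) m * (q\<^sup>2 powr (x + 1)) ^ m)
      + real m * ln q * ln_qGamma_coeff q m * z ^ m
      + \<beta> * (1 - q\<^sup>2) / 2 * ((if m = 0 then 0 else 1) * z ^ m))
    sums (2 * (L (x + 1/2) - L (x + 1)) + P (2 * x) + \<beta> * (1 - q\<^sup>2) / 2 * (z / (1 - z)))"
    using x by (intro sums_add sums_mult sums_diff sL sP sG) auto
  moreover have "2 * (ln_qGamma_coeff (q\<^sup>2) m * (q\<^sup>2 powr (x + 1/2)) ^ m
        - ln_qGamma_coeff (q\<^sup>2) m * (q\<^sup>2 powr (x + 1)) ^ m)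
      + real m * ln q * ln_qGamma_coeff q m * z ^ m
      + \<beta> * (1 - q\<^sup>2) / 2 * ((if m = 0 then 0 else 1) * z ^ m) = ln_g_coeff \<beta> q m * z ^ m" for m
  proof (cases "m = 0")
    case True
    then show ?thesis by (simp add: ln_g_coeff_def ln_qGamma_coeff_def)
  next
    case False
    define w where "w = q ^ m"
    have w: "0 < w" "w < 1" using q False by (auto simp: w_def power_less_one_iff)
    have w2: "(q\<^sup>2) ^ m = w * w" by (simp add: w_def power2_eq_square power_mult_distrib)
    have "1 - w * w = (1 - w) * (1 + w)" by (simp add: algebra_simps)
    then have gamma: "2 * (A * w - A * (w * w)) = 2 * w / (real m * (1 + w))"
      if "A = 1 / (real m * (1 - w * w))" for A
      unfolding that using w False by (simp add: divide_simps) (simp add: algebra_simps)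
    have "2 * (A * (z ^ m * w) - A * (z ^ m * (w * w))) = 2 * (A * w - A * (w * w)) * z ^ m" for A
      by (simp add: algebra_simps)
    note this[of "1 / (real m * (1 - w * w))", unfolded gamma[OF refl]]
    moreover have "real m * ln q * (1 / (real m * (1 - w))) = ln q / (1 - w)"
      using False by simp
    ultimately show ?thesis
      using False
      unfolding zx ln_qGamma_coeff_def ln_g_coeff_def power_mult_distrib w2 w_def[symmetric]
      by (simp only: if_False distrib_right mult_1)
  qed
  ultimately have "(\<lambda>m. ln_g_coeff \<beta> q m * z ^ m) sums
      (2 * (L (x + 1/2) - L (x + 1)) + P (2 * x) + \<beta> * (1 - q\<^sup>2) / 2 * (z / (1 - z)))"
    by simp
  then show ?thesis
    unfolding powr_series_def zx by (simp add: sums_iff z_def[symmetric])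
qed

lemma g_fun_eq_exp:
  assumes q: "0 < q" "q < 1" and x: "0 < x"
  shows "g_fun \<beta> q x = exp (powr_series (q\<^sup>2) (ln_g_coeff \<beta> q) x)"
proof -
  have p: "0 < q\<^sup>2" "q\<^sup>2 < 1" using q by (auto simp: power_less_one_iff)
  define L where "L = powr_series (q\<^sup>2) (ln_qGamma_coeff (q\<^sup>2))"
  define P where "P = powr_series q (\<lambda>m. real m * ln q * ln_qGamma_coeff q m)"
  define B where "B = \<beta> * (1 - q\<^sup>2) * q powr (2 * x) / (2 * (1 - q powr (2 * x)))"
  have "q_Gamma (q\<^sup>2) (x + 1/2) / q_Gamma (q\<^sup>2) (x + 1)
      = exp (ln (1 - q\<^sup>2) / 2 + (L (x + 1/2) - L (x + 1)))"
    using x by (simp add: q_Gamma_eq_exp[OF p] L_def flip: exp_diff) (simp add: algebra_simps)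
  then have "(q_Gamma (q\<^sup>2) (x + 1/2) / q_Gamma (q\<^sup>2) (x + 1))\<^sup>2
      = exp (ln (1 - q\<^sup>2) + 2 * (L (x + 1/2) - L (x + 1)))"
    by (simp add: power2_eq_square flip: exp_add)
  also have "\<dots> = (1 - q\<^sup>2) * exp (2 * (L (x + 1/2) - L (x + 1)))"
    using p by (simp add: exp_add)
  finally have sq: "(q_Gamma (q\<^sup>2) (x + 1/2) / q_Gamma (q\<^sup>2) (x + 1))\<^sup>2
      = (1 - q\<^sup>2) * exp (2 * (L (x + 1/2) - L (x + 1)))" .
  have "q_Digamma q (2 * x) = - ln (1 - q) + P (2 * x)"
    using q_Digamma_eq[OF q, of "2 * x"] x by (simp add: P_def)
  then have "exp (B + q_Digamma q (2 * x)) = exp (P (2 * x) + B) / (1 - q)"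
    using q by (simp add: exp_add exp_diff)
  then have "g_fun \<beta> q x = (1 - q\<^sup>2) / ((1 + q) * (1 - q))
      * (exp (2 * (L (x + 1/2) - L (x + 1))) * exp (P (2 * x) + B))"
    unfolding g_fun_def sq B_def[symmetric] by simp
  also have "(1 - q\<^sup>2) / ((1 + q) * (1 - q)) = 1"
  proof -
    have "1 - q\<^sup>2 = (1 + q) * (1 - q)" by (simp add: power2_eq_square algebra_simps)
    then show ?thesis using q by simp
  qed
  also have "exp (2 * (L (x + 1/2) - L (x + 1))) * exp (P (2 * x) + B)
      = exp (powr_series (q\<^sup>2) (ln_g_coeff \<beta> q) x)"
    unfolding L_def P_def B_def ln_g_expansion[OF q x, symmetric] by (simp add: exp_add)
  finally show ?thesis by simp
qed

theorem theorem2: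
  fixes q \<beta> :: real
  assumes "0 < q" and "q < 1"
    and "\<beta> \<ge> - 13 * ln q / (6 * (1 - q\<^sup>2))"
  shows "log_completely_monotonic_on (\<lambda>x. g_fun \<beta> q x) {0<..}"
proof (rule log_completely_monotonic_on_exp_powr_series)
  show "0 < q\<^sup>2" "q\<^sup>2 < 1"
    using assms(1,2) by (auto simp: power_less_one_iff)
  show "unit_disc_summable (ln_g_coeff \<beta> q)"
    by (rule unit_disc_summable_ln_g[OF assms(1,2)])
  show "0 \<le> ln_g_coeff \<beta> q m" for m
    by (rule ln_g_coeff_nonneg[OF assms])
  show "g_fun \<beta> q x = exp (powr_series (q\<^sup>2) (ln_g_coeff \<beta> q) x)" if "0 < x" for x
    by (rule g_fun_eq_exp[OF assms(1,2) that])
qed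

end
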